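(* Let $\mathcal{F}$ be an at most countable family of real-valued functions on $[0,1)$. Then there is a (single-valued) function $F:[0,1)\to\mathbb{R}$ such that, writing $\Gamma=\{(x,F(x)):x\in[0,1)\}\subset\mathbb{R}^2$ for the graph of $F$: (i) the Hausdorff dimension of $\Gamma$ equals $2$; (ii) for every $f\in\mathcal{F}$ and every $C\in\mathbb{R}$, the intersection of $\Gamma$ with the graph $\{(x,f(x)+C):x\in[0,1)\}$ consists of at most one point.
   Context: No regularity (continuity, measurability) is assumed of the functions in $\mathcal{F}$. Hausdorff dimension is the usual one for subsets of the Euclidean plane: $H^s(E)=\lim_{\delta\to0}\inf\sum_i r_i^s$, the infimum being over all at most countable covers of $E$ by disks of radii $r_i<\delta$, and $\dim_H(E)=\inf\{s\ge 0:H^s(E)=0\}$. *)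

theory Defs
  imports "HOL-Analysis.Analysis"
begin

text \<open>
  The plane is \<^typ>\<open>real \<times> real\<close>, whose library metric is the Euclidean one. Covers are indexed by
  an arbitrary (hence finite or countably infinite) set \<open>I\<close> of naturals. Disks are closed with
  positive radius; positivity matters because \<^term>\<open>0 powr 0 = (0::real)\<close>, so degenerate disks would
  be free of charge at \<open>s = 0\<close>.
\<close>

definition disk_cover ::
  "real \<Rightarrow> (real \<times> real) set \<Rightarrow> nat set \<Rightarrow> (nat \<Rightarrow> real \<times> real) \<Rightarrow> (nat \<Rightarrow> real) \<Rightarrow> bool" where
  "disk_cover \<delta> E I c r \<longleftrightarrow>
     (\<forall>i\<in>I. 0 < r i \<and> r i < \<delta>) \<and> E \<subseteq> (\<Union>i\<in>I. cball (c i) (r i))"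

definition hausdorff_premeasure :: "real \<Rightarrow> real \<Rightarrow> (real \<times> real) set \<Rightarrow> ennreal" where
  "hausdorff_premeasure s \<delta> E =
     Inf {(\<Sum>\<^sub>\<infinity>i\<in>I. ennreal (r i powr s)) | I c r. disk_cover \<delta> E I c r}"

definition hausdorff_measure :: "real \<Rightarrow> (real \<times> real) set \<Rightarrow> ennreal" where
  "hausdorff_measure s E = Lim (at_right 0) (\<lambda>\<delta>. hausdorff_premeasure s \<delta> E)"

text \<open>Valued in \<^typ>\<open>ereal\<close>, so that the infimum is meaningful without knowing the set nonempty.\<close>

definition hausdorff_dim :: "(real \<times> real) set \<Rightarrow> ereal" where
  "hausdorff_dim E = (INF s\<in>{s. 0 \<le> s \<and> hausdorff_measure s E = 0}. ereal s)"

definition graph_on :: "real set \<Rightarrow> (real \<Rightarrow> real) \<Rightarrow> (real \<times> real) set" where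
  "graph_on A f = {(x, f x) | x. x \<in> A}"

text \<open>The limit defining \<^const>\<open>hausdorff_measure\<close> always exists.\<close>

lemma hausdorff_premeasure_antimono:
  assumes "\<delta> \<le> \<delta>'"
  shows "hausdorff_premeasure s \<delta>' E \<le> hausdorff_premeasure s \<delta> E"
proof -
  have "disk_cover \<delta>' E I c r" if "disk_cover \<delta> E I c r" for I c r
    using that assms unfolding disk_cover_def by fastforce
  then show ?thesis
    unfolding hausdorff_premeasure_def by (intro Inf_superset_mono) blast
qed

lemma hausdorff_premeasure_tendsto:
  "((\<lambda>\<delta>. hausdorff_premeasure s \<delta> E) \<longlongrightarrow> (SUP \<delta>\<in>{0<..}. hausdorff_premeasure s \<delta> E)) (at_right 0)"
proof (rule order_tendstoI)
  fix a assume "a < (SUP \<delta>\<in>{0<..}. hausdorff_premeasure s \<delta> E)"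
  then obtain d where d: "0 < d" "a < hausdorff_premeasure s d E"
    by (auto simp: less_SUP_iff)
  show "\<forall>\<^sub>F \<delta> in at_right 0. a < hausdorff_premeasure s \<delta> E"
    unfolding eventually_at_right_field
    using d by (meson hausdorff_premeasure_antimono less_imp_le less_le_trans)
next
  fix a assume a: "(SUP \<delta>\<in>{0<..}. hausdorff_premeasure s \<delta> E) < a"
  have "hausdorff_premeasure s \<delta> E < a" if "0 < \<delta>" for \<delta>
    by (rule le_less_trans[OF SUP_upper a]) (use that in simp)
  then show "\<forall>\<^sub>F \<delta> in at_right 0. hausdorff_premeasure s \<delta> E < a"
    unfolding eventually_at_right_field by (intro exI[of _ 1]) simp
qed

lemma hausdorff_measure_eq_SUP:
  "hausdorff_measure s E = (SUP \<delta>\<in>{0<..}. hausdorff_premeasure s \<delta> E)"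
  unfolding hausdorff_measure_def
  by (intro tendsto_Lim hausdorff_premeasure_tendsto) simp

end

theory Submission
  imports Defs "HOL-Library.Countable_Set_Type"
begin

text \<open>
  Condition (ii) says that \<open>F - f\<close> is injective on \<open>{0..<1}\<close> for every \<open>f \<in> \<F>\<close>. This is a countable
  condition on pairs of arguments: once \<open>F y\<close> is known, only the countably many values
  \<open>F y - f y + f x\<close> are excluded for \<open>F x\<close>. So \<open>F\<close> can be built by transfinite recursion along a
  well-order of \<open>{0..<1}\<close> of minimal type: at each \<open>x\<close> fewer than continuum many values are excluded,
  and \<open>F x\<close> can still be chosen inside any prescribed set \<open>S x\<close> of the cardinality of the continuum
  (\<open>compatible_choice\<close>).

  The sets \<open>S x\<close> are used to make the graph large. Its dimension is at least \<open>2\<close> as soon as the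
  graph meets every closed subset \<open>K\<close> of positive area of the unit square: a cover by disks of small
  total \<open>s\<close>-cost, \<open>s \<le> 2\<close>, has small area, so its complement in the square contains such a \<open>K\<close>, which
  the graph would miss (\<open>hausdorff_dim_eq_2\<close>). There are at most continuum many closed \<open>K\<close>, and by
  Fubini each has a set of abscissae of positive measure, hence of continuum many points
  (\<open>reals_lepoll_pos_measure\<close>), over which the vertical slice of \<open>K\<close> has positive measure. A first
  application of \<open>compatible_choice\<close> therefore assigns to the sets \<open>K\<close> pairwise distinct such
  abscissae \<open>h K\<close>; the slice of \<open>K\<close> over \<open>h K\<close> is taken as \<open>S (h K)\<close>, and a second application
  yields \<open>F\<close>. Keeping the values of \<open>F\<close> in \<open>{0..<1}\<close> makes the upper bound \<open>2\<close> a matter of covering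
  the unit square by a grid.
\<close>

unbundle cardinal_syntax

section \<open>Choice under countably many obstructions\<close>

text \<open>
  Recursion along a well-order of \<open>I\<close> of minimal type. The index \<open>i\<close> has fewer than \<open>|I| \<le> |S i|\<close>
  predecessors, each excluding countably many values; as \<open>S i\<close> is uncountable, the excluded
  values do not exhaust it. Symmetry of \<open>bad\<close> turns the conditions on predecessors into
  conditions on all pairs.
\<close>

lemma compatible_choice:
  fixes I :: "'i set" and S :: "'i \<Rightarrow> 'a set" and bad :: "'i \<Rightarrow> 'i \<Rightarrow> 'a \<Rightarrow> 'a \<Rightarrow> bool"
  assumes large: "\<And>i. i \<in> I \<Longrightarrow> I \<lesssim> S i"
    and unc: "\<And>i. i \<in> I \<Longrightarrow> uncountable (S i)"
    and count: "\<And>i j v. countable {u. bad i j u v}"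
    and sym: "\<And>i j u v. bad i j u v \<Longrightarrow> bad j i v u"
  obtains F where "\<And>i. i \<in> I \<Longrightarrow> F i \<in> S i"
    and "\<And>i j. \<lbrakk>i \<in> I; j \<in> I; i \<noteq> j\<rbrakk> \<Longrightarrow> \<not> bad i j (F i) (F j)"
proof -
  define r where "r = |I|"
  have card: "Card_order r" and field: "Field r = I"
    unfolding r_def by (rule card_of_Card_order, rule Field_card_of)
  interpret wo_rel r
    using card_of_Well_order[of I] unfolding wo_rel_def r_def .
  define H where "H f i = (SOME u. u \<in> S i \<and> (\<forall>j\<in>underS i. \<not> bad i j u (f j)))" for f i
  define F where "F = worec H"
  have "adm_wo H"
    unfolding adm_wo_def H_def by simp
  then have rec: "F i = H F i" for i
    unfolding F_def by (metis worec_fixpoint)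
  have F: "F i \<in> S i \<and> (\<forall>j\<in>underS i. \<not> bad i j (F i) (F j))" if i: "i \<in> I" for i
  proof -
    define B where "B = (\<Union>j\<in>underS i. {u. bad i j u (F j)})"
    have "|underS i| <o r"
      using card_of_underS[OF card] i field by simp
    also have "r \<le>o |S i|"
      using large[OF i] unfolding r_def lepoll_def card_of_ordLeq by simp
    finally have 1: "|underS i| <o |S i|" .
    have 2: "|UNIV :: nat set| <o |S i|"
      using unc[OF i] unfolding countable_card_of_nat
      by (simp add: not_ordLeq_iff_ordLess card_of_Well_order)
    have inf: "infinite (S i)"
      using unc[OF i] by (auto intro: countable_finite)
    \<comment> \<open>The sum with \<^term>\<open>UNIV :: nat set\<close> is an infinite cardinal, also when there are only finitely many
      predecessors, so it absorbs a union of countable sets indexed by the predecessors.\<close>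
    have 3: "|underS i <+> (UNIV :: nat set)| <o |S i|"
      using card_of_Plus_ordLess_infinite[OF inf 1 2] .
    have "|B| \<le>o |underS i <+> (UNIV :: nat set)|"
      unfolding B_def
    proof (rule card_of_UNION_ordLeq_infinite)
      show "infinite (underS i <+> (UNIV :: nat set))" by simp
      show "|underS i| \<le>o |underS i <+> (UNIV :: nat set)|"
        by (rule card_of_Plus1)
      show "\<forall>j\<in>underS i. |{u. bad i j u (F j)}| \<le>o |underS i <+> (UNIV :: nat set)|"
        by (intro ballI ordLeq_transitive[OF _ card_of_Plus2]
            count[unfolded countable_card_of_nat])
    qed
    then have "|B| <o |S i|"
      using 3 ordLeq_ordLess_trans by blast
    then have "\<not> S i \<subseteq> B"
      using card_of_mono1 not_ordLess_ordLeq by blast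
    then obtain u where "u \<in> S i \<and> (\<forall>j\<in>underS i. \<not> bad i j u (F j))"
      unfolding B_def by blast
    then show ?thesis
      unfolding rec[of i] H_def by (rule someI)
  qed
  show thesis
  proof
    show "F i \<in> S i" if "i \<in> I" for i
      using F that by blast
    show "\<not> bad i j (F i) (F j)" if ij: "i \<in> I" "j \<in> I" "i \<noteq> j" for i j
    proof -
      have "i \<in> underS j \<or> j \<in> underS i"
        using TOTALS ij field unfolding underS_def by auto
      then show ?thesis
        using F[OF ij(1)] F[OF ij(2)] sym by blast
    qed
  qed
qed

section \<open>Sets of the cardinality of the continuum\<close>

text \<open>
  A closed set is determined by the members of a countable basis that are disjoint from it.
\<close>

lemma closed_sets_lepoll_reals:
  "{K :: 'a::second_countable_topology set. closed K} \<lesssim> (UNIV :: real set)"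
proof -
  obtain B :: "'a set set" where B: "countable B" "topological_basis B"
    using ex_countable_basis by blast
  define \<phi> where "\<phi> K = to_nat_on B ` {b\<in>B. b \<inter> K = {}}" for K
  have "inj_on \<phi> {K. closed K}"
  proof (rule inj_onI)
    fix K L :: "'a set" assume KL: "K \<in> {K. closed K}" "L \<in> {K. closed K}" "\<phi> K = \<phi> L"
    then have eq: "{b\<in>B. b \<inter> K = {}} = {b\<in>B. b \<inter> L = {}}"
      unfolding \<phi>_def using inj_on_to_nat_on[OF B(1)]
      by (subst (asm) inj_on_image_eq_iff) auto
    have compl: "- M = \<Union>{b\<in>B. b \<inter> M = {}}" if "closed M" for M :: "'a set"
    proof
      show "- M \<subseteq> \<Union>{b\<in>B. b \<inter> M = {}}"
      proof
        fix x assume "x \<in> - M"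
        moreover have "open (- M)" using that by (rule open_Compl)
        ultimately obtain b where "b \<in> B" "x \<in> b" "b \<subseteq> - M"
          using topological_basisE[OF B(2)] by metis
        then show "x \<in> \<Union>{b\<in>B. b \<inter> M = {}}" by blast
      qed
    qed blast
    show "K = L"
      using compl[of K] compl[of L] eq KL by (metis double_compl mem_Collect_eq)
  qed
  then have "{K :: 'a set. closed K} \<lesssim> (UNIV :: nat set set)"
    unfolding lepoll_def by blast
  then show ?thesis
    using nat_sets_eqpoll_reals lepoll_trans2 by blast
qed

text \<open>
  The distribution function \<open>g x = |K \<inter> {..x}|\<close> is continuous, so it takes every value between \<open>0\<close> and
  \<open>|K|\<close>; as it is constant on intervals free of \<open>K\<close>, the least point at which it takes a given value
  lies in \<open>K\<close>. Thus \<open>g\<close> maps \<open>K\<close> onto a set containing an interval.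
\<close>

lemma reals_lepoll_compact_pos_measure:
  fixes K :: "real set"
  assumes K: "compact K" and pos: "0 < measure lebesgue K"
  shows "(UNIV :: real set) \<lesssim> K"
proof -
  define m where "m = measure lebesgue K"
  define g where "g x = measure lebesgue (K \<inter> {..x})" for x
  have fm [simp]: "K \<inter> A \<in> lmeasurable" if "closed A" for A
    using K that by (simp add: compact_Int_closed lmeasurable_compact)
  have diff: "g y - g x = measure lebesgue (K \<inter> {x<..y})" if "x \<le> y" for x y
  proof -
    have "g y - g x = measure lebesgue (K \<inter> {..y} - K \<inter> {..x})"
      unfolding g_def using that by (subst measurable_measure_Diff) (auto simp: fmeasurableD)
    also have "K \<inter> {..y} - K \<inter> {..x} = K \<inter> {x<..y}" by auto
    finally show ?thesis .
  qed
  have lip: "\<bar>g y - g x\<bar> \<le> \<bar>y - x\<bar>" for x y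
  proof -
    have *: "\<bar>g y - g x\<bar> \<le> y - x" if "x \<le> y" for x y
    proof -
      have "K \<inter> {x<..y} \<in> sets lebesgue"
        using K by (intro sets.Int) (auto intro: lmeasurable_compact fmeasurableD)
      then have "measure lebesgue (K \<inter> {x<..y}) \<le> measure lebesgue {x<..y}"
        by (intro measure_mono_fmeasurable) (auto intro: bounded_set_imp_lmeasurable)
      then show ?thesis
        using that diff[OF that] by simp
    qed
    show ?thesis
      using *[of x y] *[of y x] by linarith
  qed
  have cont: "continuous_on A g" for A
    unfolding continuous_on_iff
    by (metis dist_real_def lip le_less_trans)
  obtain a b where ab: "K \<subseteq> {a..b}"
    using compact_imp_bounded[OF K] bounded_subset_cbox_symmetric[of K]
    by (metis interval_cbox)
  have K0: "K \<noteq> {}" using pos by auto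
  have ga: "g (a - 1) = 0"
  proof -
    have "K \<inter> {..a - 1} = {}" using ab by force
    then show ?thesis unfolding g_def by simp
  qed
  have gb: "g b = m"
  proof -
    have "K \<inter> {..b} = K" using ab by force
    then show ?thesis unfolding g_def m_def by simp
  qed
  have "{0<..<m} \<subseteq> g ` K"
  proof
    fix t assume t: "t \<in> {0<..<m}"
    define Z where "Z = {x \<in> {a - 1..b}. g x = t}"
    have "compact Z"
    proof -
      have "closed Z"
        unfolding Z_def by (intro continuous_closed_preimage_constant cont) simp
      moreover have "Z \<subseteq> {a - 1..b}"
        unfolding Z_def by blast
      ultimately show ?thesis
        using bounded_closed_interval bounded_subset compact_eq_bounded_closed by metis
    qed
    moreover have "Z \<noteq> {}"
      using IVT'[of g "a - 1" t b] t ga gb ab K0 cont unfolding Z_def by fastforce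
    ultimately obtain x where x: "x \<in> Z" and least: "\<And>y. y \<in> Z \<Longrightarrow> x \<le> y"
      using compact_attains_inf by metis
    have "x \<in> K"
    proof (rule ccontr)
      assume "x \<notin> K"
      then obtain e where e: "e > 0" "ball x e \<inter> K = {}"
        using compact_imp_closed[OF K]
        by (metis ComplI closed_def disjoint_eq_subset_Compl openE Int_commute)
      define y where "y = max (a - 1) (x - e / 2)"
      have "a - 1 < x"
        using x t ga unfolding Z_def by (cases "x = a - 1") auto
      then have y: "y < x" "a - 1 \<le> y" "x - e < y"
        unfolding y_def using e by auto
      have "K \<inter> {y<..x} = {}"
        using e y by (force simp: dist_real_def)
      then have "g x = g y"
        using diff[of y x] y by simp
      then have "y \<in> Z"
        using x y unfolding Z_def by auto
      then show False
        using least y by force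
    qed
    then show "t \<in> g ` K"
      using x unfolding Z_def by blast
  qed
  moreover have "{0<..<m} \<approx> (UNIV :: real set)"
    using pos unfolding m_def by (intro eqpoll_real_subset[of 0 m]) (auto simp: m_def)
  ultimately show ?thesis
    by (meson eqpoll_imp_lepoll eqpoll_sym lepoll_iff lepoll_trans1)
qed

lemma closed_subset_pos_measure:
  fixes X :: "'a::euclidean_space set"
  assumes X: "X \<in> sets borel" and pos: "0 < emeasure lborel X"
  obtains K where "closed K" "K \<subseteq> X" "0 < emeasure lborel K"
proof -
  have Xl: "X \<in> sets lebesgue" using X by simp
  obtain e :: real where e: "0 < e" "ennreal e < emeasure lborel X"
    using pos by (metis ennreal_less_zero_iff order_le_less_trans dense ennreal_cases
      not_less_iff_gr_or_eq top_greatest)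
  obtain K where K: "closed K" "K \<subseteq> X" "emeasure lebesgue (X - K) < ennreal e"
    using sets_lebesgue_inner_closed[OF Xl e(1)] by metis
  have "emeasure lborel K \<noteq> 0"
  proof
    assume 0: "emeasure lborel K = 0"
    have "emeasure lborel X \<le> emeasure lborel (X - K) + emeasure lborel K"
      using X K by (metis Diff_partition emeasure_subadditive sets.Diff sets_lborel borel_closed Un_commute)
    also have "emeasure lborel (X - K) = emeasure lebesgue (X - K)"
      using X K by simp
    finally show False
      using 0 K(3) e(2) by (simp add: not_le[symmetric])
  qed
  then show thesis
    using that K by (auto simp: zero_less_iff_neq_zero)
qed

text \<open>
  Inner regularity and countable additivity reduce this to a compact subset of positive measure.
\<close>

lemma reals_lepoll_pos_measure:
  fixes X :: "real set"
  assumes X: "X \<in> sets borel" and pos: "0 < emeasure lborel X"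
  shows "(UNIV :: real set) \<lesssim> X"
proof -
  obtain K where K: "closed K" "K \<subseteq> X" "0 < emeasure lborel K"
    using closed_subset_pos_measure[OF assms] .
  have "(\<Union>n::nat. K \<inter> {-real n..real n}) = K"
  proof -
    have "\<exists>n::nat. x \<in> {-real n..real n}" for x :: real
      using real_arch_simple[of "\<bar>x\<bar>"] by (auto simp: abs_le_iff) (metis minus_le_iff)
    then show ?thesis by blast
  qed
  moreover have "emeasure lborel (\<Union>n::nat. K \<inter> {-real n..real n}) = 0"
    if "\<And>n::nat. emeasure lborel (K \<inter> {-real n..real n}) = 0"
    using that K by (intro emeasure_UN_eq_0) auto
  ultimately obtain n :: nat where n: "emeasure lborel (K \<inter> {-real n..real n}) \<noteq> 0"
    using K by force
  define L where "L = K \<inter> {-real n..real n}"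
  have L: "compact L"
    unfolding L_def using K by (simp add: closed_Int_compact)
  have "emeasure lebesgue L = emeasure lborel L"
    using L by (simp add: borel_compact)
  moreover have "emeasure lebesgue L = ennreal (measure lebesgue L)"
    using L by (intro emeasure_eq_measure2) (auto intro: lmeasurable_compact)
  ultimately have "0 < measure lebesgue L"
    using n unfolding L_def[symmetric] by (metis ennreal_0 measure_nonneg order_le_less)
  then have "(UNIV :: real set) \<lesssim> L"
    using reals_lepoll_compact_pos_measure[OF L] by blast
  then show ?thesis
    using K unfolding L_def by (meson inf_le1 lepoll_trans subset_imp_lepoll)
qed

lemma pos_measure_slices:
  fixes K :: "('a::euclidean_space \<times> 'b::euclidean_space) set"
  assumes K: "K \<in> sets borel" and pos: "0 < emeasure lborel K"
  defines "X \<equiv> {x. 0 < emeasure lborel (Pair x -` K)}"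
  shows "X \<in> sets borel" and "0 < emeasure lborel X"
proof -
  have K': "K \<in> sets (lborel \<Otimes>\<^sub>M lborel)"
    using K unfolding lborel_prod by simp
  have meas: "(\<lambda>x. emeasure lborel (Pair x -` K)) \<in> borel_measurable lborel"
    using lborel_pair.measurable_emeasure_Pair1[OF K'] .
  then show X: "X \<in> sets borel"
    unfolding X_def by measurable
  have "emeasure lborel K = (\<integral>\<^sup>+x. emeasure lborel (Pair x -` K) \<partial>lborel)"
    using lborel.emeasure_pair_measure_alt[OF K'] unfolding lborel_prod .
  then have "emeasure lborel X \<noteq> 0"
    using pos nn_integral_0_iff[OF meas] unfolding X_def
    by (auto simp: zero_less_iff_neq_zero)
  then show "0 < emeasure lborel X"
    by (simp add: zero_less_iff_neq_zero)
qed


section \<open>Hausdorff dimension of subsets of the unit square\<close>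

lemma emeasure_cball_le_square:
  fixes c :: "real \<times> real"
  assumes "0 \<le> r"
  shows "emeasure lborel (cball c r) \<le> 4 * ennreal (r\<^sup>2)"
proof -
  obtain a b where c: "c = (a, b)" by fastforce
  have "cball c r \<subseteq> {a - r..a + r} \<times> {b - r..b + r}"
  proof (clarsimp simp: c)
    fix x y assume d: "dist (a, b) (x, y) \<le> r"
    have "dist a x \<le> r" "dist b y \<le> r"
      using dist_fst_le[of "(a, b)" "(x, y)"] dist_snd_le[of "(a, b)" "(x, y)"] d by simp_all
    then show "a - r \<le> x \<and> x \<le> a + r \<and> b - r \<le> y \<and> y \<le> b + r"
      by (auto simp: dist_real_def abs_le_iff)
  qed
  moreover have "{a - r..a + r} \<times> {b - r..b + r} \<in> sets (lborel :: (real \<times> real) measure)"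
    unfolding lborel_prod[symmetric] by simp
  ultimately have "emeasure lborel (cball c r)
      \<le> emeasure (lborel :: (real \<times> real) measure) ({a - r..a + r} \<times> {b - r..b + r})"
    by (intro emeasure_mono)
  also have "\<dots> = emeasure lborel {a - r..a + r} * emeasure lborel {b - r..b + r}"
    unfolding lborel_prod[symmetric] by (intro lborel.emeasure_pair_measure_Times) auto
  also have "\<dots> = ennreal (2 * r) * ennreal (2 * r)"
    using assms by simp
  also have "\<dots> = ennreal (4 * r\<^sup>2)"
    using assms by (simp add: ennreal_mult[symmetric] power2_eq_square)
  also have "\<dots> = 4 * ennreal (r\<^sup>2)"
    by (simp add: ennreal_mult)
  finally show ?thesis .
qed

text \<open>
  For radii below \<open>1\<close> and \<open>s \<le> 2\<close> one has \<open>r\<^sup>2 \<le> r\<^sup>s\<close>, so the \<open>s\<close>-cost of a cover controls its area.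
\<close>

lemma emeasure_Union_disks_le:
  fixes c :: "nat \<Rightarrow> real \<times> real"
  assumes r: "\<And>i. i \<in> I \<Longrightarrow> 0 < r i \<and> r i < 1" and s: "s \<le> 2"
  shows "emeasure lborel (\<Union>i\<in>I. cball (c i) (r i)) \<le> 4 * (\<Sum>\<^sub>\<infinity>i\<in>I. ennreal (r i powr s))"
proof -
  define A where "A i = (if i \<in> I then cball (c i) (r i) else {})" for i
  define g where "g i = (if i \<in> I then ennreal (r i powr s) else 0)" for i
  have A: "emeasure lborel (A i) \<le> 4 * g i" for i
  proof (cases "i \<in> I")
    case True
    then have "(r i)\<^sup>2 \<le> r i powr s"
      using r[OF True] s powr_mono'[of s 2 "r i"] by (simp add: powr_realpow)
    then have "4 * ennreal ((r i)\<^sup>2) \<le> 4 * ennreal (r i powr s)"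
      by (intro mult_left_mono ennreal_leI) auto
    then show ?thesis
      using emeasure_cball_le_square[of "r i" "c i"] r[OF True] True
      unfolding A_def g_def by (auto intro: order_trans)
  qed (simp add: A_def)
  have A_meas: "range A \<subseteq> sets lborel"
    unfolding A_def by auto
  have "(\<Union>i\<in>I. cball (c i) (r i)) = (\<Union>i. A i)"
    unfolding A_def by auto
  then have "emeasure lborel (\<Union>i\<in>I. cball (c i) (r i)) \<le> (\<Sum>i. emeasure lborel (A i))"
    using emeasure_subadditive_countably[of A lborel] A_meas by auto
  also have "\<dots> \<le> (\<Sum>i. 4 * g i)"
    using A by (intro suminf_le) auto
  also have "\<dots> = 4 * (\<Sum>i. g i)"
    by (rule ennreal_suminf_cmult)
  also have "(\<Sum>i. g i) = infsum g UNIV"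
    by (metis has_sum_infsum has_sum_imp_sums nonneg_summable_on_complete sums_unique zero_le)
  also have "infsum g UNIV = (\<Sum>\<^sub>\<infinity>i\<in>I. ennreal (r i powr s))"
    unfolding g_def by (intro infsum_cong_neutral) auto
  finally show ?thesis .
qed

lemma borel_superset_small_measure:
  assumes 0: "hausdorff_measure s E = 0" and s: "s \<le> 2" and e: "0 < (e :: real)"
  obtains U where "U \<in> sets borel" "E \<subseteq> U" "emeasure lborel U < ennreal e"
proof -
  have "hausdorff_premeasure s 1 E \<le> 0"
    unfolding 0[symmetric] hausdorff_measure_eq_SUP by (intro SUP_upper) simp
  then have "hausdorff_premeasure s 1 E < ennreal (e / 4)"
    using e by simp
  then obtain I c r where c: "disk_cover 1 E I c r"
    and small: "(\<Sum>\<^sub>\<infinity>i\<in>I. ennreal (r i powr s)) < ennreal (e / 4)"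
    unfolding hausdorff_premeasure_def Inf_less_iff by blast
  define U where "U = (\<Union>i\<in>I. cball (c i) (r i))"
  have "emeasure lborel U \<le> 4 * (\<Sum>\<^sub>\<infinity>i\<in>I. ennreal (r i powr s))"
    unfolding U_def using c s by (intro emeasure_Union_disks_le) (auto simp: disk_cover_def)
  also have "\<dots> < 4 * ennreal (e / 4)"
    using small by (intro ennreal_mult_strict_left_mono) auto
  also have "4 * ennreal (e / 4) = ennreal (4 * (e / 4))"
    using e by (subst ennreal_mult) auto
  finally have "emeasure lborel U < ennreal e" by simp
  moreover have "U \<in> sets borel"
    unfolding U_def by (intro sets.countable_UN') auto
  ultimately show thesis
    using that c unfolding U_def disk_cover_def by blast
qed

text \<open>
  The \<open>n\<^sup>2\<close> cells of a grid of mesh \<open>1 / n\<close> lie in disks of radius \<open>2 / n\<close> about their lower left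
  corners, at a total cost of order \<open>n\<^bsup>2 - s\<^esup>\<close>.
\<close>

lemma hausdorff_measure_unit_square_eq_0:
  assumes E: "E \<subseteq> {0..<1} \<times> {0..<1}" and s: "2 < s"
  shows "hausdorff_measure s E = 0"
proof -
  have "hausdorff_premeasure s \<delta> E \<le> 0" if \<delta>: "0 < \<delta>" for \<delta>
  proof (rule tendsto_lowerbound)
    define b where "b n = ennreal (2 powr s * real n powr (2 - s))" for n
    have "(\<lambda>n. 2 powr s * real n powr (2 - s)) \<longlonglongrightarrow> 2 powr s * 0"
      using s by (intro tendsto_intros tendsto_neg_powr filterlim_real_sequentially) auto
    then show "b \<longlonglongrightarrow> 0"
      unfolding b_def by (metis ennreal_0 mult_zero_right tendsto_ennrealI)
    show "\<forall>\<^sub>F n in sequentially. hausdorff_premeasure s \<delta> E \<le> b n"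
      using eventually_gt_at_top[of "nat \<lceil>2 / \<delta>\<rceil>"]
    proof eventually_elim
      case (elim n)
      then have n: "0 < n" "2 / \<delta> < real n"
        by linarith+
      \<comment> \<open>Corner number \<open>j * n + k\<close> sits in column \<open>k\<close> and row \<open>j\<close>.\<close>
      define c where "c i = (real (i mod n) / real n, real (i div n) / real n)" for i
      have r: "0 < 2 / real n" "2 / real n < \<delta>"
        using n \<delta> by (auto simp: field_simps)
      have "p \<in> (\<Union>i\<in>{..<n * n}. cball (c i) (2 / real n))" if p: "p \<in> E" for p
      proof -
        obtain x y where xy: "p = (x, y)" "0 \<le> x" "x < 1" "0 \<le> y" "y < 1"
          using p E by force
        have cell: "nat \<lfloor>z * real n\<rfloor> < n \<and> \<bar>real (nat \<lfloor>z * real n\<rfloor>) / real n - z\<bar> \<le> 1 / real n"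
          if z: "0 \<le> z" "z < 1" for z :: real
        proof -
          have z': "0 \<le> z * real n" "z * real n < real n"
            using z n by auto
          then have "nat \<lfloor>z * real n\<rfloor> < n"
            by linarith
          moreover have "\<bar>real (nat \<lfloor>z * real n\<rfloor>) - z * real n\<bar> \<le> 1"
            using z' by linarith
          then have "\<bar>(real (nat \<lfloor>z * real n\<rfloor>) - z * real n) / real n\<bar> \<le> 1 / real n"
            using n by (simp add: divide_right_mono)
          then have "\<bar>real (nat \<lfloor>z * real n\<rfloor>) / real n - z\<bar> \<le> 1 / real n"
            using n by (simp add: diff_divide_distrib)
          ultimately show ?thesis by blast
        qed
        define k where "k = nat \<lfloor>x * real n\<rfloor>"
        define j where "j = nat \<lfloor>y * real n\<rfloor>"
        have k: "k < n" "\<bar>real k / real n - x\<bar> \<le> 1 / real n"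
          unfolding k_def using cell[of x] xy by auto
        have j: "j < n" "\<bar>real j / real n - y\<bar> \<le> 1 / real n"
          unfolding j_def using cell[of y] xy by auto
        have "j * n + k < Suc j * n" using k by simp
        also have "\<dots> \<le> n * n" using j by (intro mult_right_mono) auto
        finally have lt: "j * n + k < n * n" .
        have ci: "c (j * n + k) = (real k / real n, real j / real n)"
          unfolding c_def using k by simp
        have "dist (c (j * n + k)) p \<le> \<bar>real k / real n - x\<bar> + \<bar>real j / real n - y\<bar>"
          unfolding ci xy dist_Pair_Pair dist_real_def
          using sqrt_sum_squares_le_sum_abs by simp
        also have "\<dots> \<le> 2 / real n" using k j by simp
        finally show ?thesis using lt by force
      qed
      then have "disk_cover \<delta> E {..<n * n} c (\<lambda>i. 2 / real n)"
        unfolding disk_cover_def using r by blast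
      then have "hausdorff_premeasure s \<delta> E
          \<le> (\<Sum>\<^sub>\<infinity>i\<in>{..<n * n}. ennreal ((2 / real n) powr s))"
        unfolding hausdorff_premeasure_def by (intro Inf_lower CollectI exI conjI) auto
      also have "\<dots> = ennreal (real (n * n)) * ennreal ((2 / real n) powr s)"
        by (simp add: ennreal_of_nat_eq_real_of_nat)
      also have "\<dots> = ennreal (real (n * n) * (2 / real n) powr s)"
        by (simp add: ennreal_mult)
      also have "real (n * n) * (2 / real n) powr s = 2 powr s * real n powr (2 - s)"
        using n by (simp add: powr_divide powr_diff power2_eq_square)
      finally show ?case unfolding b_def .
    qed
  qed simp
  then show ?thesis
    unfolding hausdorff_measure_eq_SUP by (simp add: SUP_eq_iff bot_ennreal antisym)
qed

text \<open>
  The graph built below may be non-measurable, so its area is of no use as a lower bound. The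
  hypothesis says instead that the set has full outer measure in the square, which is enough
  to exclude covers of small total cost.
\<close>

lemma hausdorff_dim_eq_2:
  assumes E: "E \<subseteq> {0..<1} \<times> {0..<1}"
    and meets: "\<And>K. \<lbrakk>closed K; K \<subseteq> {0..<1} \<times> {0..<1}; 0 < emeasure lborel K\<rbrakk> \<Longrightarrow> E \<inter> K \<noteq> {}"
  shows "hausdorff_dim E = 2"
proof (rule antisym)
  have *: "hausdorff_dim E \<le> ereal s" if "2 < s" for s
    unfolding hausdorff_dim_def using that hausdorff_measure_unit_square_eq_0[OF E]
    by (intro INF_lower) auto
  show "hausdorff_dim E \<le> 2"
  proof (rule ccontr)
    assume "\<not> hausdorff_dim E \<le> 2"
    then obtain s where "2 < ereal s" "ereal s < hausdorff_dim E"
      using ereal_dense2[of 2 "hausdorff_dim E"] unfolding not_le by blast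
    then show False
      using *[of s] by auto
  qed
next
  define Q :: "(real \<times> real) set" where "Q = {0..<1} \<times> {0..<1}"
  have Q: "Q \<in> sets borel"
    unfolding Q_def sets_lborel[symmetric] lborel_prod[symmetric] by simp
  have Q1: "emeasure lborel Q = 1"
    unfolding Q_def lborel_prod[symmetric]
    by (subst lborel.emeasure_pair_measure_Times) auto
  show "2 \<le> hausdorff_dim E"
    unfolding hausdorff_dim_def
  proof (rule INF_greatest, rule ccontr)
    fix s assume "s \<in> {s. 0 \<le> s \<and> hausdorff_measure s E = 0}" and "\<not> 2 \<le> ereal s"
    then have "hausdorff_measure s E = 0" "s \<le> 2" by auto
    then obtain U where U: "U \<in> sets borel" "E \<subseteq> U" "emeasure lborel U < ennreal 1"
      using borel_superset_small_measure[of s E 1] by auto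
    have "emeasure lborel (Q - U) \<noteq> 0"
    proof
      assume 0: "emeasure lborel (Q - U) = 0"
      have "emeasure lborel Q \<le> emeasure lborel ((Q - U) \<union> U)"
        using Q U by (intro emeasure_mono) auto
      also have "\<dots> \<le> emeasure lborel (Q - U) + emeasure lborel U"
        using Q U by (intro emeasure_subadditive) auto
      finally show False
        using 0 Q1 U(3) by simp
    qed
    then obtain K where "closed K" "K \<subseteq> Q - U" "0 < emeasure lborel K"
      using closed_subset_pos_measure[of "Q - U"] Q U by (auto simp: zero_less_iff_neq_zero)
    then show False
      using meets[of K] U(2) unfolding Q_def by blast
  qed
qed

section \<open>The function\<close>

text \<open>
  Prescribing a point of the graph in each \<open>K\<close> and defining \<open>F\<close> at all remaining arguments must
  happen in one recursion: after continuum many points have been chosen there may be no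
  admissible value left for a further argument. For this reason the abscissae \<open>h K\<close> are fixed
  beforehand, and the recursion for \<open>F\<close> runs over its whole domain.
\<close>

lemma function_meeting_closed_sets:
  fixes bad :: "real \<Rightarrow> real \<Rightarrow> real \<Rightarrow> real \<Rightarrow> bool"
  assumes count: "\<And>x y v. countable {u. bad x y u v}"
    and sym: "\<And>x y u v. bad x y u v \<Longrightarrow> bad y x v u"
  obtains F where "\<And>x. x \<in> {0..<1} \<Longrightarrow> F x \<in> {0..<1}"
    and "\<And>K. \<lbrakk>closed K; K \<subseteq> {0..<1} \<times> {0..<1}; 0 < emeasure lborel K\<rbrakk> \<Longrightarrow> graph_on {0..<1} F \<inter> K \<noteq> {}"
    and "\<And>x y. \<lbrakk>x \<in> {0..<1}; y \<in> {0..<1}; x \<noteq> y\<rbrakk> \<Longrightarrow> \<not> bad x y (F x) (F y)"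
proof -
  define \<K> :: "(real \<times> real) set set" where
    "\<K> = {K. closed K \<and> K \<subseteq> {0..<1} \<times> {0..<1} \<and> 0 < emeasure lborel K}"
  define X where "X K = {x :: real. 0 < emeasure (lborel :: real measure) (Pair x -` K)}"
    for K :: "(real \<times> real) set"
  have unc: "uncountable A" if "(UNIV :: real set) \<lesssim> A" for A :: "real set"
    using that uncountable_UNIV_real countable_lepoll by blast
  have X: "(UNIV :: real set) \<lesssim> X K" if "K \<in> \<K>" for K
    using that unfolding X_def \<K>_def
    by (intro reals_lepoll_pos_measure pos_measure_slices) auto
  have "\<K> \<lesssim> (UNIV :: real set)"
    by (rule lepoll_trans[OF subset_imp_lepoll closed_sets_lepoll_reals]) (auto simp: \<K>_def)
  then have large: "\<K> \<lesssim> X K" if "K \<in> \<K>" for K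
    using X[OF that] lepoll_trans by blast
  \<comment> \<open>Distinct choices: \<open>compatible_choice\<close> with equality as the obstruction.\<close>
  obtain h where hX: "\<And>K. K \<in> \<K> \<Longrightarrow> h K \<in> X K"
    and hinj: "\<And>K L. \<lbrakk>K \<in> \<K>; L \<in> \<K>; K \<noteq> L\<rbrakk> \<Longrightarrow> h K \<noteq> h L"
    using compatible_choice[of \<K> X "\<lambda>_ _ u v. u = v"] large X unc
    by (metis countable_insert_eq countable_empty singleton_conv)
  have inj: "inj_on h \<K>"
    using hinj by (meson inj_onI)
  define S where "S x = (if x \<in> h ` \<K> then Pair x -` inv_into \<K> h x else {0..<1})" for x
  have S: "(UNIV :: real set) \<lesssim> S x" if x: "x \<in> {0..<1}" for x
  proof (cases "x \<in> h ` \<K>")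
    case True
    then obtain K where K: "K \<in> \<K>" "x = h K" by blast
    have "S x = Pair x -` K"
      unfolding S_def using K inj by simp
    moreover have "Pair x -` K \<in> sets borel"
      using K(1) sets_Pair1[of K lborel lborel x] unfolding lborel_prod \<K>_def by simp
    moreover have "0 < emeasure lborel (Pair x -` K)"
      using hX[OF K(1)] K(2) unfolding X_def by simp
    ultimately show ?thesis
      using reals_lepoll_pos_measure by simp
  next
    case False
    then show ?thesis
      unfolding S_def using reals_lepoll_reals01 by simp
  qed
  have S01: "S x \<subseteq> {0..<1}" for x
  proof (cases "x \<in> h ` \<K>")
    case True
    then have "inv_into \<K> h x \<in> \<K>" by (rule inv_into_into)
    then show ?thesis unfolding S_def \<K>_def using True by auto
  qed (simp add: S_def)
  have large': "{0..<1 :: real} \<lesssim> S x" if "x \<in> {0..<1}" for x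
    using S[OF that] by (meson lepoll_trans subset_UNIV subset_imp_lepoll)
  obtain F where FS: "\<And>x. x \<in> {0..<1} \<Longrightarrow> F x \<in> S x"
    and Fbad: "\<And>x y. \<lbrakk>x \<in> {0..<1}; y \<in> {0..<1}; x \<noteq> y\<rbrakk> \<Longrightarrow> \<not> bad x y (F x) (F y)"
    using compatible_choice[of "{0..<1 :: real}" S bad, OF large' _ count sym] S unc by metis
  show thesis
  proof
    show "F x \<in> {0..<1}" if "x \<in> {0..<1}" for x
      using FS[OF that] S01 by blast
    show "graph_on {0..<1} F \<inter> K \<noteq> {}"
      if "closed K" "K \<subseteq> {0..<1} \<times> {0..<1}" "0 < emeasure lborel K" for K
    proof -
      have K: "K \<in> \<K>" using that unfolding \<K>_def by blast
      have "Pair (h K) -` K \<noteq> {}"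
        using hX[OF K] unfolding X_def by auto
      then have hK: "h K \<in> {0..<1}"
        using that(2) by auto
      moreover have "S (h K) = Pair (h K) -` K"
        unfolding S_def using K inj by simp
      ultimately have "(h K, F (h K)) \<in> K"
        using FS[OF hK] by blast
      then show ?thesis
        unfolding graph_on_def using hK by blast
    qed
    show "\<not> bad x y (F x) (F y)" if "x \<in> {0..<1}" "y \<in> {0..<1}" "x \<noteq> y" for x y
      using Fbad that .
  qed
qed

theorem theorem1p1:
  fixes \<F> :: "(real \<Rightarrow> real) set"
  assumes "countable \<F>"
  shows "\<exists>F :: real \<Rightarrow> real.
           hausdorff_dim (graph_on {0..<1} F) = 2 \<and>
           (\<forall>f\<in>\<F>. \<forall>C :: real.
              \<exists>\<^sub>\<le>\<^sub>1 p. p \<in> graph_on {0..<1} F \<inter> graph_on {0..<1} (\<lambda>x. f x + C))"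
proof -
  \<comment> \<open>Values at \<open>x\<close> and \<open>y\<close> that would put both points on a common translate of a graph in \<open>\<F>\<close>.\<close>
  define bad where "bad x y u v \<longleftrightarrow> (\<exists>f\<in>\<F>. u - f x = v - f y)" for x y u v :: real
  have "{u. bad x y u v} = (\<lambda>f. v - f y + f x) ` \<F>" for x y v
    unfolding bad_def image_def by (intro Collect_cong bex_cong refl) linarith
  then have count: "countable {u. bad x y u v}" for x y v
    using assms by simp
  have sym: "bad y x v u" if "bad x y u v" for x y u v
    using that unfolding bad_def by metis
  show ?thesis
  proof (rule function_meeting_closed_sets[of bad, OF count sym])
    fix F
    assume F01: "\<And>x. x \<in> {0..<1} \<Longrightarrow> F x \<in> {0..<1}"
      and meets: "\<And>K. \<lbrakk>closed K; K \<subseteq> {0..<1} \<times> {0..<1}; 0 < emeasure lborel K\<rbrakk>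
        \<Longrightarrow> graph_on {0..<1} F \<inter> K \<noteq> {}"
      and good: "\<And>x y. \<lbrakk>x \<in> {0..<1}; y \<in> {0..<1}; x \<noteq> y\<rbrakk> \<Longrightarrow> \<not> bad x y (F x) (F y)"
    have "hausdorff_dim (graph_on {0..<1} F) = 2"
      using F01 meets by (intro hausdorff_dim_eq_2) (auto simp: graph_on_def)
    moreover have "\<exists>\<^sub>\<le>\<^sub>1 p. p \<in> graph_on {0..<1} F \<inter> graph_on {0..<1} (\<lambda>x. f x + C)"
      if f: "f \<in> \<F>" for f C
    proof (rule Uniq_I)
      fix p q
      assume "p \<in> graph_on {0..<1} F \<inter> graph_on {0..<1} (\<lambda>x. f x + C)"
        and "q \<in> graph_on {0..<1} F \<inter> graph_on {0..<1} (\<lambda>x. f x + C)"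
      then obtain x y where x: "x \<in> {0..<1}" "p = (x, F x)" "F x = f x + C"
        and y: "y \<in> {0..<1}" "q = (y, F y)" "F y = f y + C"
        unfolding graph_on_def by auto
      then have "bad x y (F x) (F y)"
        unfolding bad_def using f by (intro bexI[of _ f]) auto
      then show "p = q"
        using good[of x y] x y by blast
    qed
    ultimately show ?thesis by blast
  qed
qed

end
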